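(* Let $R$ be a commutative ring with unity $1\neq 0$ and let $n>1$ be an integer. Let $\mathcal{MT}_n$ be the set of all $n$-tuples of polynomials of the form $$\vec f=(f_1(x_1),\ f_2(x_1)+x_2g_2(x_1),\ \ldots,\ f_n(x_1,\ldots,x_{n-1})+x_ng_n(x_1,\ldots,x_{n-1})),$$ where $f_1\in R[x_1]$ is a permutation polynomial on $R$ and, for $i=2,\ldots,n$, $f_i\in R[x_1,\ldots,x_{i-1}]$ and $g_i\in R[x_1,\ldots,x_{i-1}]$ is unit-valued. Then $\mathcal{MT}_n$ is a monoid of vector-permutation polynomials with respect to composition (that is, $\mathcal{MT}_n$ is a monoid under $\circ$, and every element of $\mathcal{MT}_n$ induces a bijection of $R^n$). Moreover, if $R$ is finite, then $\pi_n(\mathcal{MT}_n)$ is a group of permutations of $R^n$.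
   Context: A polynomial $g\in R[x_1,\ldots,x_k]$ is unit-valued if $g(a)\in R^\times$ for all $a\in R^k$. A polynomial $f\in R[x_1]$ is a permutation polynomial on $R$ if $a\mapsto f(a)$ is a bijection of $R$. A vector-polynomial is an element $\vec f=(f_1,\ldots,f_n)\in R[x_1,\ldots,x_n]^n$; composition is $\vec f\circ\vec g=(f_1(g_1,\ldots,g_n),\ldots,f_n(g_1,\ldots,g_n))$, with identity $(x_1,\ldots,x_n)$. The map $\pi_n$ sends $\vec f$ to the function $R^n\to R^n$, $a\mapsto (f_1(a),\ldots,f_n(a))$, that it induces. $\vec f$ is a vector-permutation polynomial if $\pi_n(\vec f)$ is a bijection of $R^n$. *)

theory Defs
  imports "HOL-Library.Poly_Mapping" "HOL-Library.FuncSet" "HOL-Algebra.Bij"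
begin

text \<open>
  The ring \<open>R\<close> is a type \<open>'a :: comm_ring_1\<close> (so \<open>1 \<noteq> 0\<close>). Polynomials over \<open>R\<close> in the
  variables \<open>x\<^sub>0, x\<^sub>1, x\<^sub>2, \<dots>\<close> are finitely supported maps from monomials (finitely supported
  exponent maps) to coefficients; the ring structure is the convolution instance of the library.
  The variable \<open>x\<^sub>0\<close> is not used: \<open>R[x\<^sub>1,\<dots>,x\<^sub>k]\<close> is the set \<open>polys k\<close> of those polynomials in
  which only variables with index in \<open>{1..k}\<close> occur. Points of \<open>R\<^sup>k\<close> and vector-polynomials are
  extensional functions on \<open>{1..k}\<close>, so that equality is equality of tuples.
\<close>

type_synonym 'a mpoly = "(nat \<Rightarrow>\<^sub>0 nat) \<Rightarrow>\<^sub>0 'a"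

definition Const :: "'a::comm_ring_1 \<Rightarrow> 'a mpoly" where
  "Const c = Poly_Mapping.single 0 c"

definition Var :: "nat \<Rightarrow> 'a::comm_ring_1 mpoly" where
  "Var i = Poly_Mapping.single (Poly_Mapping.single i 1) 1"

definition vars :: "'a::comm_ring_1 mpoly \<Rightarrow> nat set" where
  "vars p = (\<Union>m\<in>Poly_Mapping.keys p. Poly_Mapping.keys m)"

definition polys :: "nat \<Rightarrow> 'a::comm_ring_1 mpoly set" where
  "polys k = {p. vars p \<subseteq> {1..k}}"

definition points :: "nat \<Rightarrow> (nat \<Rightarrow> 'a::comm_ring_1) set" where
  "points k = {1..k} \<rightarrow>\<^sub>E UNIV"

text \<open>
  The value of \<open>p\<close> when each variable \<open>x\<^sub>i\<close> is replaced by \<open>s i\<close> and each coefficient \<open>c\<close> by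
  \<open>h c\<close>. For \<open>h = id\<close> this is evaluation at a point, for \<open>h = Const\<close> it is substitution of
  polynomials for the variables.
\<close>

definition eval_hom ::
    "('a::comm_ring_1 \<Rightarrow> 'b::comm_ring_1) \<Rightarrow> (nat \<Rightarrow> 'b) \<Rightarrow> 'a mpoly \<Rightarrow> 'b" where
  "eval_hom h s p =
     (\<Sum>m\<in>Poly_Mapping.keys p. h (Poly_Mapping.lookup p m) *
        (\<Prod>i\<in>Poly_Mapping.keys m. s i ^ Poly_Mapping.lookup m i))"

definition peval :: "(nat \<Rightarrow> 'a::comm_ring_1) \<Rightarrow> 'a mpoly \<Rightarrow> 'a" where
  "peval a p = eval_hom id a p"

definition psubst :: "(nat \<Rightarrow> 'a::comm_ring_1 mpoly) \<Rightarrow> 'a mpoly \<Rightarrow> 'a mpoly" where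
  "psubst g p = eval_hom Const g p"

definition unit_valued :: "nat \<Rightarrow> 'a::comm_ring_1 mpoly \<Rightarrow> bool" where
  "unit_valued k g \<longleftrightarrow> g \<in> polys k \<and> (\<forall>a\<in>points k. peval a g dvd 1)"

definition permutation_poly :: "'a::comm_ring_1 mpoly \<Rightarrow> bool" where
  "permutation_poly f \<longleftrightarrow> f \<in> polys 1 \<and> bij (\<lambda>a. peval (\<lambda>_. a) f)"

definition vector_polys :: "nat \<Rightarrow> (nat \<Rightarrow> 'a::comm_ring_1 mpoly) set" where
  "vector_polys n = {1..n} \<rightarrow>\<^sub>E polys n"

definition vcomp ::
    "nat \<Rightarrow> (nat \<Rightarrow> 'a::comm_ring_1 mpoly) \<Rightarrow> (nat \<Rightarrow> 'a mpoly) \<Rightarrow> (nat \<Rightarrow> 'a mpoly)" where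
  "vcomp n F G = (\<lambda>i\<in>{1..n}. psubst G (F i))"

definition vid :: "nat \<Rightarrow> (nat \<Rightarrow> 'a::comm_ring_1 mpoly)" where
  "vid n = (\<lambda>i\<in>{1..n}. Var i)"

definition induced_map ::
    "nat \<Rightarrow> (nat \<Rightarrow> 'a::comm_ring_1 mpoly) \<Rightarrow> (nat \<Rightarrow> 'a) \<Rightarrow> (nat \<Rightarrow> 'a)" where
  "induced_map n F = (\<lambda>a\<in>points n. \<lambda>i\<in>{1..n}. peval a (F i))"

definition vector_permutation_polys :: "nat \<Rightarrow> (nat \<Rightarrow> 'a::comm_ring_1 mpoly) set" where
  "vector_permutation_polys n =
     {F \<in> vector_polys n. bij_betw (induced_map n F) (points n) (points n)}"

definition MT :: "nat \<Rightarrow> (nat \<Rightarrow> 'a::comm_ring_1 mpoly) set" where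
  "MT n = {F \<in> vector_polys n. permutation_poly (F 1) \<and>
     (\<forall>i\<in>{2..n}. \<exists>f\<in>polys (i - 1). \<exists>g\<in>polys (i - 1).
        unit_valued (i - 1) g \<and> F i = f + Var i * g)}"

definition MT_monoid :: "nat \<Rightarrow> (nat \<Rightarrow> 'a::comm_ring_1 mpoly) monoid" where
  "MT_monoid n = \<lparr>carrier = MT n, mult = vcomp n, one = vid n\<rparr>"

end

theory Submission
  imports Defs "HOL-Algebra.Multiplicative_Group"
begin

text \<open>
  Triangularity makes everything work one coordinate at a time: once the first \<open>i - 1\<close>
  coordinates of a point are fixed, the \<open>i\<close>-th component of an element of \<open>MT n\<close> is a bijection
  of \<open>R\<close> as a function of the \<open>i\<close>-th coordinate (a permutation polynomial for \<open>i = 1\<close>, an affine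
  map \<open>t \<mapsto> c + t u\<close> with \<open>u\<close> a unit otherwise). Hence the induced map is a bijection. Substitution
  is a ring homomorphism, so \<open>f + x\<^sub>i g\<close> composed with \<open>G\<close>, where \<open>G\<^sub>i = f' + x\<^sub>i g'\<close>, is
  \<open>(f(G) + f' g(G)) + x\<^sub>i (g' g(G))\<close>, and \<open>g' g(G)\<close> is again unit-valued. For finite \<open>R\<close>, a
  submonoid of a finite group is a subgroup.
\<close>

section \<open>Substitution homomorphisms\<close>

text \<open>A common interface for coefficient maps (\<open>id\<close>, \<open>Const\<close>) and
  for the evaluations built from them. Since \<open>eval_hom h s\<close> is again an instance, the
  laws for \<open>peval\<close> and \<open>psubst\<close> are proved once.\<close>

locale unital_ring_hom =
  fixes h :: "'a::comm_ring_1 \<Rightarrow> 'b::comm_ring_1"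
  assumes hom_zero: "h 0 = 0"
    and hom_one: "h 1 = 1"
    and hom_add: "h (x + y) = h x + h y"
    and hom_mult: "h (x * y) = h x * h y"
begin

lemma hom_sum: "h (\<Sum>x\<in>A. f x) = (\<Sum>x\<in>A. h (f x))"
  by (induction A rule: infinite_finite_induct) (simp_all add: hom_zero hom_add)

lemma hom_prod: "h (\<Prod>x\<in>A. f x) = (\<Prod>x\<in>A. h (f x))"
  by (induction A rule: infinite_finite_induct) (simp_all add: hom_one hom_mult)

lemma hom_power: "h (x ^ k) = h x ^ k"
  by (induction k) (simp_all add: hom_one hom_mult)

text \<open>A homomorphism passes through the finite sum of products. Taking \<open>h\<close> to be
  an evaluation or a substitution gives the composition laws \<open>peval_psubst\<close> and
  \<open>psubst_psubst\<close>.\<close>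

lemma hom_eval_hom: "h (eval_hom g s p) = eval_hom (\<lambda>c. h (g c)) (\<lambda>i. h (s i)) p"
  by (simp add: eval_hom_def hom_sum hom_prod hom_mult hom_power)

end

lemma eval_hom_cong:
  assumes "\<And>i. i \<in> vars p \<Longrightarrow> s i = t i"
  shows "eval_hom h s p = eval_hom h t p"
  unfolding eval_hom_def
  by (intro sum.cong prod.cong arg_cong2[where f = "(*)"] arg_cong2[where f = "(^)"] refl assms)
    (auto simp: vars_def)

section \<open>Evaluation as a ring homomorphism\<close>

definition eval_monom :: "(nat \<Rightarrow> 'b::comm_ring_1) \<Rightarrow> (nat \<Rightarrow>\<^sub>0 nat) \<Rightarrow> 'b" where
  "eval_monom s m = (\<Prod>i\<in>Poly_Mapping.keys m. s i ^ Poly_Mapping.lookup m i)"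

text \<open>Added indices have exponent 0 and contribute a factor 1. This lets two monomials share
  one index set.\<close>

lemma eval_monom_superset:
  assumes "finite K" "Poly_Mapping.keys m \<subseteq> K"
  shows "eval_monom s m = (\<Prod>i\<in>K. s i ^ Poly_Mapping.lookup m i)"
  unfolding eval_monom_def using assms
  by (intro prod.mono_neutral_left) (auto simp: in_keys_iff)

lemma eval_monom_zero [simp]: "eval_monom s 0 = 1"
  by (simp add: eval_monom_def)

lemma eval_monom_add: "eval_monom s (m + m') = eval_monom s m * eval_monom s m'"
proof -
  let ?K = "Poly_Mapping.keys m \<union> Poly_Mapping.keys m'"
  have "eval_monom s (m + m') = (\<Prod>i\<in>?K. s i ^ Poly_Mapping.lookup (m + m') i)"
    by (intro eval_monom_superset keys_add) simp
  also have "\<dots> = (\<Prod>i\<in>?K. s i ^ Poly_Mapping.lookup m i) * (\<Prod>i\<in>?K. s i ^ Poly_Mapping.lookup m' i)"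
    by (simp add: lookup_add power_add prod.distrib)
  also have "\<dots> = eval_monom s m * eval_monom s m'"
    by (simp add: eval_monom_superset[of ?K])
  finally show ?thesis .
qed

text \<open>Updating at a fresh key amounts to adding a monomial, so identities that are additive in
  \<open>p\<close> reduce to single monomials.\<close>

lemma mpoly_induct [case_names zero add]:
  fixes p :: "'a::comm_ring_1 mpoly"
  assumes "P 0" and "\<And>p m c. P p \<Longrightarrow> P (p + Poly_Mapping.single m c)"
  shows "P p"
proof (induction p rule: update_induct)
  case const
  show ?case by (fact assms(1))
next
  case (update p m c)
  have "Poly_Mapping.update m c p = p + Poly_Mapping.single m c"
    using update(1)
    by (intro poly_mapping_eqI)
      (auto simp: lookup_update lookup_add lookup_single when_def in_keys_iff)
  then show ?case using assms(2)[OF update(3)] by simp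
qed

context unital_ring_hom
begin

lemma eval_hom_superset:
  assumes "finite K" "Poly_Mapping.keys p \<subseteq> K"
  shows "eval_hom h s p = (\<Sum>m\<in>K. h (Poly_Mapping.lookup p m) * eval_monom s m)"
  unfolding eval_hom_def eval_monom_def using assms
  by (intro sum.mono_neutral_left) (auto simp: in_keys_iff hom_zero)

lemma eval_hom_zero: "eval_hom h s 0 = 0"
  by (simp add: eval_hom_def)

lemma eval_hom_single: "eval_hom h s (Poly_Mapping.single m c) = h c * eval_monom s m"
  by (simp add: eval_hom_def eval_monom_def hom_zero)

lemma eval_hom_add: "eval_hom h s (p + q) = eval_hom h s p + eval_hom h s q"
proof -
  let ?K = "Poly_Mapping.keys p \<union> Poly_Mapping.keys q"
  have "eval_hom h s (p + q) = (\<Sum>m\<in>?K. h (Poly_Mapping.lookup (p + q) m) * eval_monom s m)"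
    by (intro eval_hom_superset keys_add) simp
  also have "\<dots> = (\<Sum>m\<in>?K. h (Poly_Mapping.lookup p m) * eval_monom s m)
      + (\<Sum>m\<in>?K. h (Poly_Mapping.lookup q m) * eval_monom s m)"
    by (simp add: lookup_add hom_add distrib_right sum.distrib)
  also have "\<dots> = eval_hom h s p + eval_hom h s q"
    by (simp add: eval_hom_superset[of ?K])
  finally show ?thesis .
qed

text \<open>Both sides are additive in \<open>p\<close> and in \<open>q\<close>. The nested
  inductions reduce the claim to two monomials, where exponents add and coefficients
  multiply.\<close>

lemma eval_hom_mult: "eval_hom h s (p * q) = eval_hom h s p * eval_hom h s q"
proof (induction p rule: mpoly_induct)
  case zero
  show ?case by (simp add: eval_hom_zero)
next
  case (add p m c)
  have "eval_hom h s (Poly_Mapping.single m c * q) = h c * eval_monom s m * eval_hom h s q"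
    by (induction q rule: mpoly_induct)
      (simp_all add: eval_hom_zero eval_hom_add eval_hom_single mult_single eval_monom_add
        hom_mult algebra_simps)
  with add show ?case
    by (simp add: eval_hom_add eval_hom_single algebra_simps)
qed

lemma eval_hom_Const: "eval_hom h s (Const c) = h c"
  by (simp add: Const_def eval_hom_single)

lemma eval_hom_Var: "eval_hom h s (Var i) = s i"
  by (simp add: Var_def eval_hom_single hom_one eval_monom_def)

lemma unital_ring_hom_eval_hom: "unital_ring_hom (eval_hom h s)"
proof
  show "eval_hom h s 1 = 1"
    by (metis eval_hom_Const Const_def hom_one single_one)
qed (simp_all add: eval_hom_zero eval_hom_add eval_hom_mult)

end

section \<open>Evaluation at points and substitution of polynomials\<close>

interpretation id_hom: unital_ring_hom id
  by standard auto

interpretation Const_hom: unital_ring_hom Const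
  by standard (simp_all add: Const_def single_add mult_single)

interpretation peval_hom: unital_ring_hom "peval a" for a
  using id_hom.unital_ring_hom_eval_hom[of a] by (simp add: peval_def[abs_def])

interpretation psubst_hom: unital_ring_hom "psubst G" for G
  using Const_hom.unital_ring_hom_eval_hom[of G] by (simp add: psubst_def[abs_def])

lemma peval_Var [simp]: "peval a (Var i) = a i"
  by (simp add: peval_def id_hom.eval_hom_Var)

lemma psubst_Var [simp]: "psubst G (Var i) = G i"
  by (simp add: psubst_def Const_hom.eval_hom_Var)

lemma peval_psubst: "peval a (psubst G p) = peval (\<lambda>i. peval a (G i)) p"
  using peval_hom.hom_eval_hom[of a Const G p]
  by (simp add: psubst_def peval_def id_hom.eval_hom_Const[unfolded id_def] id_def)

lemma psubst_psubst: "psubst H (psubst G p) = psubst (\<lambda>i. psubst H (G i)) p"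
  using psubst_hom.hom_eval_hom[of H Const G p]
  by (simp add: psubst_def Const_hom.eval_hom_Const)

text \<open>Every monomial is the product of the powers of its variables; additivity extends this to
  polynomials.\<close>

lemma psubst_Var_id: "psubst Var p = p"
proof (induction p rule: mpoly_induct)
  case zero
  show ?case by (rule psubst_hom.hom_zero)
next
  case (add p m c)
  have "Poly_Mapping.single (Poly_Mapping.single i 1) (1::'a) ^ k
      = Poly_Mapping.single (Poly_Mapping.single i k) 1" for i :: nat and k
    by (induction k) (simp_all add: mult_single single_add[symmetric])
  then have pow: "(Var i :: 'a mpoly) ^ k = Poly_Mapping.single (Poly_Mapping.single i k) 1" for i k
    by (simp add: Var_def)
  \<comment> \<open>For infinite \<open>K\<close> the empty-product and empty-sum defaults make both
    sides 1.\<close>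
  have "(\<Prod>i\<in>K. Poly_Mapping.single (e i) (1::'a)) = Poly_Mapping.single (\<Sum>i\<in>K. e i) 1"
    for e :: "nat \<Rightarrow> nat \<Rightarrow>\<^sub>0 nat" and K
    by (induction K rule: infinite_finite_induct) (simp_all add: mult_single)
  then have "eval_monom Var m = Poly_Mapping.single
      (\<Sum>i\<in>Poly_Mapping.keys m. Poly_Mapping.single i (Poly_Mapping.lookup m i)) (1::'a)"
    by (simp add: eval_monom_def pow)
  also have "(\<Sum>i\<in>Poly_Mapping.keys m. Poly_Mapping.single i (Poly_Mapping.lookup m i)) = m"
    by (intro poly_mapping_eqI)
      (simp add: lookup_sum lookup_single when_def in_keys_iff)
  finally have "psubst Var (Poly_Mapping.single m c) = Poly_Mapping.single m c"
    by (simp add: psubst_def Const_hom.eval_hom_single Const_def mult_single)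
  then show ?case using add by (simp add: psubst_hom.hom_add)
qed

section \<open>Polynomials in the first variables\<close>

lemma peval_cong:
  assumes "p \<in> polys k" "\<And>i. i \<in> {1..k} \<Longrightarrow> a i = b i"
  shows "peval a p = peval b p"
  unfolding peval_def using assms by (intro eval_hom_cong) (auto simp: polys_def)

lemma psubst_cong:
  assumes "p \<in> polys k" "\<And>i. i \<in> {1..k} \<Longrightarrow> G i = H i"
  shows "psubst G p = psubst H p"
  unfolding psubst_def using assms by (intro eval_hom_cong) (auto simp: polys_def)

lemma polys_mono: "k \<le> l \<Longrightarrow> polys k \<subseteq> polys l"
  by (fastforce simp: polys_def)

lemma polys_zero: "0 \<in> polys k"
  by (simp add: polys_def vars_def)

lemma polys_Const: "Const c \<in> polys k"
  by (simp add: polys_def vars_def Const_def)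

lemma polys_one: "1 \<in> polys k"
  using polys_Const[of 1] by (simp add: Const_hom.hom_one)

lemma polys_Var: "i \<in> {1..k} \<Longrightarrow> Var i \<in> polys k"
  by (simp add: polys_def vars_def Var_def)

lemma polys_add: "p \<in> polys k \<Longrightarrow> q \<in> polys k \<Longrightarrow> p + q \<in> polys k"
  using keys_add[of p q] unfolding polys_def vars_def by blast

lemma polys_mult:
  assumes "p \<in> polys k" "q \<in> polys k"
  shows "p * q \<in> polys k"
proof -
  have "Poly_Mapping.keys m \<subseteq> {1..k}" if "m \<in> Poly_Mapping.keys (p * q)" for m
  proof -
    from that keys_mult[of p q] obtain u v
      where "u \<in> Poly_Mapping.keys p" "v \<in> Poly_Mapping.keys q" "m = u + v"
      by blast
    with assms keys_add[of u v] show ?thesis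
      unfolding polys_def vars_def by blast
  qed
  then show ?thesis
    unfolding polys_def vars_def by blast
qed

lemma polys_power: "p \<in> polys k \<Longrightarrow> p ^ e \<in> polys k"
  by (induction e) (simp_all add: polys_one polys_mult)

lemma polys_sum: "(\<And>x. x \<in> A \<Longrightarrow> f x \<in> polys k) \<Longrightarrow> (\<Sum>x\<in>A. f x) \<in> polys k"
  by (induction A rule: infinite_finite_induct) (simp_all add: polys_zero polys_add)

lemma polys_prod: "(\<And>x. x \<in> A \<Longrightarrow> f x \<in> polys k) \<Longrightarrow> (\<Prod>x\<in>A. f x) \<in> polys k"
  by (induction A rule: infinite_finite_induct) (simp_all add: polys_one polys_mult)

lemma polys_psubst:
  assumes "p \<in> polys k" "\<And>i. i \<in> {1..k} \<Longrightarrow> G i \<in> polys l"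
  shows "psubst G p \<in> polys l"
  unfolding psubst_def eval_hom_def
proof (intro polys_sum polys_mult polys_Const polys_prod polys_power assms(2))
  fix m i
  assume "m \<in> Poly_Mapping.keys p" "i \<in> Poly_Mapping.keys m"
  with assms(1) show "i \<in> {1..k}"
    unfolding polys_def vars_def by blast
qed

text \<open>The definition speaks of extensional points only. Since \<open>g\<close> sees only the
  first \<open>k\<close> coordinates, restricting \<open>a\<close> to them does not change the
  value, so \<open>a\<close> may be any assignment.\<close>

lemma unit_valuedD:
  assumes "unit_valued k g"
  shows "g \<in> polys k" "peval a g dvd 1"
proof -
  show *: "g \<in> polys k"
    using assms by (simp add: unit_valued_def)
  have "peval (restrict a {1..k}) g dvd 1"
    using assms by (simp add: unit_valued_def points_def)
  also have "peval (restrict a {1..k}) g = peval a g"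
    using * by (rule peval_cong) simp
  finally show "peval a g dvd 1" .
qed

section \<open>Triangular vector-polynomials\<close>

text \<open>With \<open>u * v = 1\<close>, the inverse is
  \<open>y \<mapsto> (y - c) * v\<close>.\<close>

lemma bij_affine:
  fixes c u :: "'a::comm_ring_1"
  assumes "u dvd 1"
  shows "bij (\<lambda>t. c + t * u)"
proof -
  from assms obtain v where v: "1 = u * v"
    by (rule dvdE)
  have "(c + t * u - c) * v = t" "c + (t - c) * v * u = t" for t
    using v by (simp_all add: mult.assoc mult.commute[of v u] flip: v)
  then show ?thesis
    by (intro o_bij[of "\<lambda>y. (y - c) * v"]) (simp_all only: o_def id_def)
qed

lemma MT_cases [consumes 2, case_names first later]:
  assumes "F \<in> MT n" "i \<in> {1..n}"
  obtains "i = 1" "permutation_poly (F 1)"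
  | f g where "i \<ge> 2" "f \<in> polys (i - 1)" "unit_valued (i - 1) g" "F i = f + Var i * g"
proof (cases "i = 1")
  case True
  with assms that(1) show ?thesis by (simp add: MT_def)
next
  case False
  with assms(2) have "i \<in> {2..n}" by auto
  with assms(1) that(2) show ?thesis by (fastforce simp: MT_def)
qed

lemma polys_affine:
  assumes "i \<ge> 1" "f \<in> polys (i - 1)" "g \<in> polys (i - 1)"
  shows "f + Var i * g \<in> polys i"
  using assms polys_mono[of "i - 1" i] by (intro polys_add polys_mult polys_Var) auto

lemma MT_polys:
  assumes "F \<in> MT n" "i \<in> {1..n}"
  shows "F i \<in> polys i"
  using assms
proof (cases rule: MT_cases)
  case first
  then show ?thesis by (simp add: permutation_poly_def)
next
  case (later f g)
  then show ?thesis by (simp add: polys_affine unit_valuedD)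
qed

text \<open>Membership in \<open>vector_polys n\<close> comes from the triangular shape, because
  \<open>polys i \<subseteq> polys n\<close> for \<open>i \<le> n\<close>.\<close>

lemma MT_I:
  assumes "F \<in> extensional {1..n}" "permutation_poly (F 1)"
    and "\<And>i. i \<in> {2..n} \<Longrightarrow>
      \<exists>f g. f \<in> polys (i - 1) \<and> unit_valued (i - 1) g \<and> F i = f + Var i * g"
  shows "F \<in> MT n"
proof -
  have "F i \<in> polys n" if "i \<in> {1..n}" for i
  proof (cases "i = 1")
    case True
    with assms(2) that polys_mono[of 1 n] show ?thesis by (auto simp: permutation_poly_def)
  next
    case False
    with that have i: "i \<in> {2..n}" by auto
    then obtain f g where "f \<in> polys (i - 1)" "unit_valued (i - 1) g" "F i = f + Var i * g"
      using assms(3) by blast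
    with i have "F i \<in> polys i" by (simp add: polys_affine unit_valuedD)
    with that polys_mono[of i n] show ?thesis by auto
  qed
  then have "F \<in> vector_polys n"
    using assms(1) by (simp add: vector_polys_def PiE_iff)
  then show ?thesis
    unfolding MT_def using assms(2,3) unit_valuedD(1) by blast
qed

lemma MT_extensional: "F \<in> MT n \<Longrightarrow> F \<in> extensional {1..n}"
  by (simp add: MT_def vector_polys_def PiE_iff)

lemma MT_coordinate_bij:
  assumes "F \<in> MT n" "i \<in> {1..n}"
  shows "bij (\<lambda>t. peval (a(i := t)) (F i))"
  using assms
proof (cases rule: MT_cases)
  case first
  \<comment> \<open>\<open>F 1\<close> involves only the first variable, so the point may be
    replaced by the constant assignment used in \<open>permutation_poly\<close>.\<close>
  then have "peval (a(1 := t)) (F 1) = peval (\<lambda>_. t) (F 1)" for t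
    by (intro peval_cong[of _ 1]) (auto simp: permutation_poly_def)
  with first show ?thesis by (simp add: permutation_poly_def)
next
  case (later f g)
  \<comment> \<open>Changing coordinate \<open>i\<close> does not affect \<open>f\<close> and
    \<open>g\<close>; they supply the constant term and the unit slope.\<close>
  have "peval (a(i := t)) p = peval a p" if "p \<in> polys (i - 1)" for t p
    using that by (rule peval_cong) (use later(1) in auto)
  with later have "peval (a(i := t)) (F i) = peval a f + t * peval a g" for t
    by (simp add: peval_hom.hom_add peval_hom.hom_mult unit_valuedD(1))
  with later show ?thesis by (simp add: bij_affine unit_valuedD(2))
qed

section \<open>Bijectivity of the induced map\<close>

lemma MT_induced_map_bij:
  assumes F: "F \<in> MT n"
  shows "bij_betw (induced_map n F) (points n) (points n)"
  unfolding bij_betw_def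
proof
  show "inj_on (induced_map n F) (points n)"
  proof (rule inj_onI)
    fix a b
    assume a: "a \<in> points n" and b: "b \<in> points n"
      and eq: "induced_map n F a = induced_map n F b"
    have "a i = b i" if "i \<in> {1..n}" for i
      using that
    proof (induction i rule: less_induct)
      case (less i)
      \<comment> \<open>By induction \<open>a\<close> and \<open>b\<close> agree below
        \<open>i\<close>, so after this update they agree on all variables of \<open>F i\<close>.
        Injectivity in coordinate \<open>i\<close> then forces \<open>a i = b i\<close>.\<close>
      have "peval (b(i := a i)) (F i) = peval a (F i)"
        using MT_polys[OF F less.prems] less by (intro peval_cong[of _ i]) auto
      also have "\<dots> = peval b (F i)"
        using fun_cong[OF eq, of i] a b less.prems by (simp add: induced_map_def)
      also have "\<dots> = peval (b(i := b i)) (F i)"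
        by simp
      finally show ?case
        by (rule injD[OF bij_is_inj[OF MT_coordinate_bij[OF F less.prems, of b]]])
    qed
    with a b show "a = b"
      unfolding points_def by (metis PiE_ext)
  qed
  show "induced_map n F ` points n = points n"
  proof
    show "induced_map n F ` points n \<subseteq> points n"
      by (auto simp: induced_map_def points_def)
    show "points n \<subseteq> induced_map n F ` points n"
    proof
      fix b :: "nat \<Rightarrow> 'a"
      assume b: "b \<in> points n"
      \<comment> \<open>A preimage is found by solving the first \<open>k\<close> equations, with
        the values of \<open>a\<close> at other indices left arbitrary.\<close>
      have "\<exists>a. \<forall>i\<in>{1..k}. peval a (F i) = b i" if "k \<le> n" for k
        using that
      proof (induction k)
        case 0
        show ?case by simp
      next
        case (Suc k)
        then obtain a where a: "\<And>i. i \<in> {1..k} \<Longrightarrow> peval a (F i) = b i"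
          using Suc_leD by blast
        have k: "Suc k \<in> {1..n}" using Suc.prems by simp
        obtain t where t: "b (Suc k) = peval (a(Suc k := t)) (F (Suc k))"
          using surjD[OF bij_is_surj[OF MT_coordinate_bij[OF F k, of a]]] by blast
        \<comment> \<open>The equations already solved survive, since \<open>F i\<close> with
          \<open>i \<le> k\<close> does not see coordinate \<open>Suc k\<close>.\<close>
        have "peval (a(Suc k := t)) (F i) = peval a (F i)" if "i \<in> {1..k}" for i
          using that Suc.prems MT_polys[OF F, of i] by (intro peval_cong[of _ i]) auto
        with a t have "peval (a(Suc k := t)) (F i) = b i" if "i \<in> {1..Suc k}" for i
          using that by (cases "i = Suc k") auto
        then show ?case by blast
      qed
      then obtain a where a: "\<And>i. i \<in> {1..n} \<Longrightarrow> peval a (F i) = b i"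
        by blast
      \<comment> \<open>Cutting the solution down to \<open>{1..n}\<close> makes it an extensional
        point.\<close>
      let ?a = "restrict a {1..n}"
      have "peval ?a (F i) = b i" if "i \<in> {1..n}" for i
        using a[OF that] peval_cong[OF MT_polys[OF F that], of ?a a] that by simp
      moreover have mem: "?a \<in> points n"
        by (simp add: points_def)
      ultimately have map: "induced_map n F ?a \<in> points n" "\<And>i. i \<in> {1..n} \<Longrightarrow> induced_map n F ?a i = b i"
        by (simp_all add: induced_map_def points_def)
      have "induced_map n F ?a = b"
        using map(1) b map(2) unfolding points_def by (rule PiE_ext)
      with mem show "b \<in> induced_map n F ` points n"
        by blast
    qed
  qed
qed

section \<open>Closure under composition and the monoid laws\<close>

lemma MT_vcomp:
  assumes n: "n > 1" and F: "F \<in> MT n" and G: "G \<in> MT n"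
  shows "vcomp n F G \<in> MT n"
proof (rule MT_I)
  show "vcomp n F G \<in> extensional {1..n}"
    by (simp add: vcomp_def)
  have one: "1 \<in> {1..n}" using n by simp
  have perm: "permutation_poly (F 1)" "permutation_poly (G 1)"
    using F G by (simp_all add: MT_def)
  \<comment> \<open>As \<open>F 1\<close> sees only the first variable, substitution of
    \<open>G\<close> is one-variable composition with \<open>G 1\<close>, and bijections
    compose.\<close>
  have "peval (\<lambda>_. a) (psubst G (F 1)) = peval (\<lambda>_. peval (\<lambda>_. a) (G 1)) (F 1)" for a
    unfolding peval_psubst using MT_polys[OF F one] by (intro peval_cong[of _ 1]) auto
  then have "(\<lambda>a. peval (\<lambda>_. a) (psubst G (F 1)))
      = (\<lambda>a. peval (\<lambda>_. a) (F 1)) \<circ> (\<lambda>a. peval (\<lambda>_. a) (G 1))"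
    by (simp add: fun_eq_iff)
  moreover have "psubst G (F 1) \<in> polys 1"
    using MT_polys[OF F one] MT_polys[OF G one] by (intro polys_psubst[of _ 1]) auto
  ultimately show "permutation_poly (vcomp n F G 1)"
    using perm one by (simp add: vcomp_def permutation_poly_def bij_comp)
next
  fix i assume i: "i \<in> {2..n}"
  then have i': "i \<in> {1..n}" and "i \<noteq> 1" by auto
  from F i' \<open>i \<noteq> 1\<close> obtain f g
    where f: "f \<in> polys (i - 1)" and g: "unit_valued (i - 1) g" and Fi: "F i = f + Var i * g"
    by (cases rule: MT_cases) auto
  from G i' \<open>i \<noteq> 1\<close> obtain f' g'
    where f': "f' \<in> polys (i - 1)" and g': "unit_valued (i - 1) g'" and Gi: "G i = f' + Var i * g'"
    by (cases rule: MT_cases) auto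
  \<comment> \<open>Triangularity of \<open>G\<close>: each \<open>G j\<close> with
    \<open>j < i\<close> uses only variables up to \<open>j\<close>, so no later variable
    enters.\<close>
  have subst: "psubst G p \<in> polys (i - 1)" if "p \<in> polys (i - 1)" for p
    using that
  proof (rule polys_psubst)
    fix j assume "j \<in> {1..i - 1}"
    with i MT_polys[OF G, of j] polys_mono[of j "i - 1"] show "G j \<in> polys (i - 1)" by auto
  qed
  have "psubst G f + f' * psubst G g \<in> polys (i - 1)"
    using f f' g subst by (simp add: polys_add polys_mult unit_valuedD)
  moreover have "unit_valued (i - 1) (g' * psubst G g)"
    unfolding unit_valued_def
  proof (intro conjI ballI)
    show "g' * psubst G g \<in> polys (i - 1)"
      using g g' subst by (simp add: polys_mult unit_valuedD)
    fix a :: "nat \<Rightarrow> 'a"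
    \<comment> \<open>The second value is that of \<open>g\<close> at the assignment
      \<open>j \<mapsto> peval a (G j)\<close>, hence a unit.\<close>
    have "peval a g' dvd 1" "peval a (psubst G g) dvd 1"
      using unit_valuedD(2)[OF g] unit_valuedD(2)[OF g'] by (simp_all add: peval_psubst)
    then show "peval a (g' * psubst G g) dvd 1"
      using mult_dvd_mono[of _ 1 _ 1] by (simp add: peval_hom.hom_mult)
  qed
  moreover have "vcomp n F G i = (psubst G f + f' * psubst G g) + Var i * (g' * psubst G g)"
    using i' by (simp add: vcomp_def Fi Gi psubst_hom.hom_add psubst_hom.hom_mult algebra_simps)
  ultimately show "\<exists>f g. f \<in> polys (i - 1) \<and> unit_valued (i - 1) g \<and> vcomp n F G i = f + Var i * g"
    by blast
qed

lemma MT_vid: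
  assumes "n > 1"
  shows "vid n \<in> MT n"
proof (rule MT_I)
  show "vid n \<in> extensional {1..n}"
    by (simp add: vid_def)
  show "permutation_poly (vid n 1)"
    using assms polys_Var[of 1 1] by (simp add: vid_def permutation_poly_def bij_id[unfolded id_def])
next
  fix i assume "i \<in> {2..n}"
  then have "vid n i = 0 + Var i * 1"
    by (simp add: vid_def)
  moreover have "unit_valued (i - 1) 1"
    by (simp add: unit_valued_def polys_one peval_hom.hom_one)
  ultimately show "\<exists>f g. f \<in> polys (i - 1) \<and> unit_valued (i - 1) g \<and> vid n i = f + Var i * g"
    using polys_zero by blast
qed

lemma vector_polysD: "F \<in> vector_polys n \<Longrightarrow> i \<in> {1..n} \<Longrightarrow> F i \<in> polys n"
  by (auto simp: vector_polys_def)

text \<open>\<open>psubst_psubst\<close> substitutes at every index, while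
  \<open>vcomp n G H\<close> is cut to \<open>{1..n}\<close>. The two agree on the variables of each
  \<open>F i\<close>, by the hypothesis on \<open>F\<close>.\<close>

lemma vcomp_assoc:
  assumes "F \<in> vector_polys n"
  shows "vcomp n (vcomp n F G) H = vcomp n F (vcomp n G H)"
proof
  fix i
  show "vcomp n (vcomp n F G) H i = vcomp n F (vcomp n G H) i"
  proof (cases "i \<in> {1..n}")
    case True
    then have "psubst (\<lambda>j. psubst H (G j)) (F i) = psubst (vcomp n G H) (F i)"
      using vector_polysD[OF assms] by (intro psubst_cong[of _ n]) (auto simp: vcomp_def)
    with True show ?thesis by (simp add: vcomp_def psubst_psubst)
  qed (auto simp: vcomp_def)
qed

lemma vcomp_vid_left: "F \<in> extensional {1..n} \<Longrightarrow> vcomp n (vid n) F = F"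
  by (auto simp: vcomp_def vid_def fun_eq_iff extensional_def)

lemma vcomp_vid_right:
  assumes "F \<in> vector_polys n"
  shows "vcomp n F (vid n) = F"
proof
  fix i
  show "vcomp n F (vid n) i = F i"
  proof (cases "i \<in> {1..n}")
    case True
    then have "psubst (vid n) (F i) = psubst Var (F i)"
      using vector_polysD[OF assms] by (intro psubst_cong[of _ n]) (auto simp: vid_def)
    with True show ?thesis by (simp add: vcomp_def psubst_Var_id)
  next
    case False
    then have "F i = undefined"
      using assms unfolding vector_polys_def by (intro PiE_arb)
    with False show ?thesis by (auto simp: vcomp_def)
  qed
qed

lemma MT_vector_polys: "F \<in> MT n \<Longrightarrow> F \<in> vector_polys n"
  by (simp add: MT_def)

lemma monoid_MT:
  assumes "n > 1"
  shows "monoid (MT_monoid n)"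
  by (rule monoidI)
    (simp_all add: MT_monoid_def MT_vcomp[OF assms] MT_vid[OF assms] vcomp_vid_left[OF MT_extensional]
      vcomp_vid_right vcomp_assoc MT_vector_polys)

section \<open>Induced permutations\<close>

lemma induced_map_vid: "induced_map n (vid n) = (\<lambda>a\<in>points n. a)"
proof
  fix a
  have "(\<lambda>i\<in>{1..n}. peval a (vid n i)) = a" if "a \<in> points n"
    using that PiE_restrict[of a "{1..n}" "\<lambda>_. UNIV"]
    by (simp add: vid_def points_def cong: restrict_cong)
  then show "induced_map n (vid n) a = (\<lambda>a\<in>points n. a) a"
    by (simp add: induced_map_def)
qed

text \<open>This makes \<pi>_n multiplicative, in the order of composition that
  \<open>BijGroup\<close> uses.\<close>

lemma induced_map_vcomp:
  assumes "F \<in> vector_polys n"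
  shows "induced_map n (vcomp n F G) = compose (points n) (induced_map n F) (induced_map n G)"
proof
  fix a
  show "induced_map n (vcomp n F G) a = compose (points n) (induced_map n F) (induced_map n G) a"
  proof (cases "a \<in> points n")
    case True
    \<comment> \<open>Substitution evaluates \<open>F i\<close> at an untruncated tuple, the induced
      map at a truncated one; \<open>F i\<close> cannot tell them apart.\<close>
    have "peval (\<lambda>j. peval a (G j)) (F i) = peval (\<lambda>j\<in>{1..n}. peval a (G j)) (F i)"
      if "i \<in> {1..n}" for i
      using vector_polysD[OF assms that] by (rule peval_cong) simp
    moreover have "(\<lambda>j\<in>{1..n}. peval a (G j)) \<in> points n"
      by (simp add: points_def)
    ultimately show ?thesis
      using True by (auto simp: induced_map_def vcomp_def compose_def peval_psubst fun_eq_iff)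
  qed (simp add: induced_map_def compose_def)
qed

text \<open>In a finite group of order \<open>k + 1\<close> the inverse of \<open>x\<close> is the
  power \<open>x [^] k\<close>, which lies in every submonoid containing \<open>x\<close>.\<close>

lemma (in group) finite_submonoid_imp_subgroup:
  assumes "finite (carrier G)" "submonoid H G"
  shows "subgroup H G"
proof (rule submonoid_subgroupI)
  interpret H: submonoid H G by fact
  fix x assume x: "x \<in> H"
  then have xG: "x \<in> carrier G" by simp
  have pow: "x [^] k \<in> H" for k :: nat
    by (induction k) (simp_all add: x)
  obtain k where k: "order G = Suc k"
    using assms(1) order_gt_0_iff_finite gr0_implies_Suc by blast
  have "x [^] k \<otimes> x = \<one>"
    using pow_order_eq_1[OF xG] by (simp add: k)
  then have "inv x = x [^] k"
    using xG by (simp add: inv_equality)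
  with pow show "inv x \<in> H" by simp
qed fact

lemma subgroup_induced_map_MT:
  assumes n: "n > 1" and fin: "finite (UNIV :: 'a::comm_ring_1 set)"
  shows "subgroup (induced_map n ` (MT n :: (nat \<Rightarrow> 'a mpoly) set))
    (BijGroup (points n :: (nat \<Rightarrow> 'a) set))"
proof -
  let ?P = "points n :: (nat \<Rightarrow> 'a) set"
  interpret group "BijGroup ?P" by (rule group_BijGroup)
  have "finite ?P"
    unfolding points_def using fin by (intro finite_PiE) auto
  \<comment> \<open>Finiteness of the permutation group: its elements lie in the finite space of
    extensional self-maps of \<open>?P\<close>.\<close>
  moreover have "Bij ?P \<subseteq> ?P \<rightarrow>\<^sub>E ?P"
    unfolding PiE_def by (intro subsetI IntI Bij_imp_funcset Bij_imp_extensional)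
  ultimately have "finite (carrier (BijGroup ?P))"
    by (auto simp: BijGroup_def intro: finite_subset finite_PiE)
  moreover have Bij: "induced_map n F \<in> Bij ?P" if "F \<in> MT n" for F
    using MT_induced_map_bij[OF that] by (simp add: Bij_def induced_map_def)
  have "submonoid (induced_map n ` MT n) (BijGroup ?P)"
  proof
    show "induced_map n ` MT n \<subseteq> carrier (BijGroup ?P)"
      using Bij by (auto simp: BijGroup_def)
    show "\<one>\<^bsub>BijGroup ?P\<^esub> \<in> induced_map n ` MT n"
      using MT_vid[OF n] by (auto simp: BijGroup_def induced_map_vid[symmetric])
    fix x y :: "(nat \<Rightarrow> 'a) \<Rightarrow> nat \<Rightarrow> 'a"
    assume "x \<in> induced_map n ` MT n" "y \<in> induced_map n ` MT n"
    then obtain F G where FG: "F \<in> MT n" "G \<in> MT n" "x = induced_map n F" "y = induced_map n G"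
      by blast
    \<comment> \<open>Multiplication in \<open>BijGroup\<close> is specified only on
      \<open>Bij ?P\<close>, so bijectivity of both factors is used to unfold it.\<close>
    then have "x \<otimes>\<^bsub>BijGroup ?P\<^esub> y = induced_map n (vcomp n F G)"
      using Bij by (simp add: BijGroup_def induced_map_vcomp MT_def)
    with FG MT_vcomp[OF n] show "x \<otimes>\<^bsub>BijGroup ?P\<^esub> y \<in> induced_map n ` MT n"
      by blast
  qed
  ultimately show ?thesis
    by (rule finite_submonoid_imp_subgroup)
qed

theorem theorem3p3:
  fixes n :: nat
  assumes "n > 1"
  shows "monoid (MT_monoid n :: (nat \<Rightarrow> 'a::comm_ring_1 mpoly) monoid)
       \<and> (MT n :: (nat \<Rightarrow> 'a mpoly) set) \<subseteq> vector_permutation_polys n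
       \<and> (finite (UNIV :: 'a set) \<longrightarrow>
            subgroup (induced_map n ` (MT n :: (nat \<Rightarrow> 'a mpoly) set))
                     (BijGroup (points n :: (nat \<Rightarrow> 'a) set)))"
proof (intro conjI impI)
  show "monoid (MT_monoid n :: (nat \<Rightarrow> 'a mpoly) monoid)"
    using assms by (rule monoid_MT)
  show "(MT n :: (nat \<Rightarrow> 'a mpoly) set) \<subseteq> vector_permutation_polys n"
    using MT_induced_map_bij by (auto simp: vector_permutation_polys_def MT_def)
qed (rule subgroup_induced_map_MT[OF assms])

end
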